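(* Let $X$ be a compact scattered metric space whose Cantor-Bendixson height $\operatorname{ht}(X)$ is a (nonzero) limit ordinal. Then $X$ is not homeomorphic to any IFS-attractor consisting of weak contractions; that is, there is no compact metric space $Y$ homeomorphic to $X$ and finite family of weak contractions $f_1,\dots,f_n:Y\to Y$ with $Y=\bigcup_{i=1}^n f_i(Y)$. In particular, $X$ is not a topological IFS-attractor.
   Context: A topological space is scattered if every nonempty subspace $Y$ has an isolated point in $Y$. The Cantor-Bendixson derivative $X'$ is the set of accumulation points of $X$; define $X^{(0)}=X$, $X^{(\alpha+1)}=(X^{(\alpha)})'$ and $X^{(\alpha)}=\bigcap_{\beta<\alpha}X^{(\beta)}$ for limit $\alpha$. The (Cantor-Bendixson) height of a scattered space is $\operatorname{ht}(X)=\min\{\alpha : X^{(\alpha)}\text{ is discrete}\}$. On a metric space $(Y,d)$, a contraction is a map $f:Y\to Y$ for which there is $\alpha\in(0,1)$ with $d(f(x),f(y))\le\alpha\, d(x,y)$ for all $x,y\in Y$; a weak contraction is a map $f:Y\to Y$ with $d(f(x),f(y))<d(x,y)$ for all $x\ne y$ in $Y$. A compact metric space $Y$ is an IFS-attractor if $Y=\bigcup_{i=1}^n f_i(Y)$ for some finite family of contractions $f_1,\dots,f_n:Y\to Y$; it is an IFS-attractor consisting of weak contractions if the same holds with weak contractions $f_i$. A space is a topological IFS-attractor if it is homeomorphic to some IFS-attractor (equivalently, it admits a compatible metric making it an IFS-attractor). *)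

theory Defs
  imports "HOL-Analysis.Analysis"
begin

section \<open>Ordinals\<close>

text \<open>
  The type \<open>'a ordinal\<close> consists of the order types of the well-orders on sets of elements of \<open>'a\<close>.
  It is an initial segment of the ordinals, long enough that it does not inject into \<open>'a\<close>
  (lemma \<open>not_inj_ordinal\<close>), and hence contains the Cantor-Bendixson height of every scattered
  space whose points are of type \<open>'a\<close> (lemma \<open>scattered_imp_discrete_CB_derivative\<close>).
\<close>

quotient_type 'a ordinal = "'a rel" / partial: "\<lambda>r s. (r, s) \<in> ordIso"
proof (rule part_equivpI)
  have "Well_order ({} :: 'a rel)"
    by simp
  then show "\<exists>x :: 'a rel. (x, x) \<in> ordIso"
    using ordIso_reflexive by blast
  show "symp (\<lambda>r s :: 'a rel. (r, s) \<in> ordIso)"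
    by (auto intro: sympI ordIso_symmetric)
  show "transp (\<lambda>r s :: 'a rel. (r, s) \<in> ordIso)"
    by (auto intro: transpI ordIso_transitive)
qed

lemma ordIso_refl_imp_Well_order: "(r, r) \<in> ordIso \<Longrightarrow> Well_order r"
  by (simp add: ordIso_def)

instantiation ordinal :: (type) wellorder
begin

lift_definition less_eq_ordinal :: "'a ordinal \<Rightarrow> 'a ordinal \<Rightarrow> bool"
  is "\<lambda>r s. (r, s) \<in> ordLeq"
  by (meson ordIso_ordLeq_trans ordLeq_ordIso_trans ordIso_symmetric)

lift_definition less_ordinal :: "'a ordinal \<Rightarrow> 'a ordinal \<Rightarrow> bool"
  is "\<lambda>r s. (r, s) \<in> ordLess"
  by (meson ordIso_ordLess_trans ordLess_ordIso_trans ordIso_symmetric)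

instance
proof
  fix x y z :: "'a ordinal"
  show "x < y \<longleftrightarrow> x \<le> y \<and> \<not> y \<le> x"
    by transfer (meson not_ordLess_ordLeq ordLess_imp_ordLeq ordLess_or_ordLeq
        ordIso_refl_imp_Well_order)
  show "x \<le> x"
    by transfer (simp add: ordIso_iff_ordLeq)
  show "x \<le> y \<Longrightarrow> y \<le> z \<Longrightarrow> x \<le> z"
    by transfer (rule ordLeq_transitive)
  show "x \<le> y \<Longrightarrow> y \<le> x \<Longrightarrow> x = y"
    by transfer (simp add: ordIso_iff_ordLeq)
  show "x \<le> y \<or> y \<le> x"
    by transfer (meson ordLess_imp_ordLeq ordLess_or_ordLeq ordIso_refl_imp_Well_order)
next
  fix P :: "'a ordinal \<Rightarrow> bool" and a
  assume step: "\<And>x. (\<And>y. y < x \<Longrightarrow> P y) \<Longrightarrow> P x"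
  have wf: "wf {(x, y :: 'a ordinal). x < y}"
  proof (rule wf_subset)
    show "wf (inv_image ordLess (rep_ordinal :: 'a ordinal \<Rightarrow> 'a rel))"
      by (intro wf_inv_image wf_ordLess)
    show "{(x, y :: 'a ordinal). x < y} \<subseteq> inv_image ordLess rep_ordinal"
      by (auto simp: less_ordinal.rep_eq)
  qed
  show "P a"
    using wf by (rule wf_induct_rule) (use step in auto)
qed

end

definition zero_ord :: "'o::wellorder \<Rightarrow> bool" where
  "zero_ord \<alpha> \<longleftrightarrow> (\<forall>\<beta>. \<alpha> \<le> \<beta>)"

definition succ_ord_of :: "'o::wellorder \<Rightarrow> 'o \<Rightarrow> bool" where
  "succ_ord_of \<beta> \<alpha> \<longleftrightarrow> \<beta> < \<alpha> \<and> (\<forall>\<gamma>. \<beta> < \<gamma> \<longrightarrow> \<alpha> \<le> \<gamma>)"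

definition limit_ord :: "'o::wellorder \<Rightarrow> bool" where
  "limit_ord \<alpha> \<longleftrightarrow> \<not> zero_ord \<alpha> \<and> \<not> (\<exists>\<beta>. succ_ord_of \<beta> \<alpha>)"

definition pred_ord :: "'o::wellorder \<Rightarrow> 'o" where
  "pred_ord \<alpha> = (THE \<beta>. succ_ord_of \<beta> \<alpha>)"

lemma succ_ord_of_unique: "succ_ord_of \<beta> \<alpha> \<Longrightarrow> succ_ord_of \<beta>' \<alpha> \<Longrightarrow> \<beta>' = \<beta>"
  unfolding succ_ord_of_def by (metis antisym_conv3 leD)

lemma pred_ord_eq: "succ_ord_of \<beta> \<alpha> \<Longrightarrow> pred_ord \<alpha> = \<beta>"
  unfolding pred_ord_def by (rule the_equality) (auto dest: succ_ord_of_unique)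

lemma pred_ord_less: "succ_ord_of \<beta> \<alpha> \<Longrightarrow> pred_ord \<alpha> < \<alpha>"
  by (simp add: pred_ord_eq) (simp add: succ_ord_of_def)

lemma not_inj_ordinal: "\<not> inj (f :: 'a ordinal \<Rightarrow> 'a)"
proof
  assume inj: "inj f"
  define r where "r = dir_image {(x, y). x \<le> y} f"
  have field: "Field {(x, y :: 'a ordinal). x \<le> y} = UNIV"
    by (auto simp: Field_def)
  have wf: "wf ({(x, y :: 'a ordinal). x \<le> y} - Id)"
    using wf by (rule wf_subset) auto
  have "Well_order {(x, y :: 'a ordinal). x \<le> y}"
    unfolding well_order_on_def linear_order_on_def partial_order_on_def preorder_on_def field
    using wf by (auto simp: refl_on_def trans_def antisym_def total_on_def)
  then have r: "Well_order r"
    unfolding r_def using inj by (intro Well_order_dir_image) (auto intro: inj_on_subset)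
  have r_iff: "(f x, f y) \<in> r \<longleftrightarrow> x \<le> y" for x y
    using inj by (auto simp: r_def dir_image_def inj_eq)
  have Field_r: "f x \<in> Field r" for x
    using r_iff[of x x] by (auto simp: Field_def)
  define seg where "seg x = Restr r (underS r (f x))" for x
  have seg_wo: "Well_order (seg x)" for x
    unfolding seg_def using r by (rule Well_order_Restr)
  have seg_less: "(seg x, r) \<in> ordLess" for x
    unfolding seg_def using r Field_r[of x] by (intro underS_Restr_ordLess) auto
  have seg_mono: "(seg x, seg y) \<in> ordLess" if "x < y" for x y
  proof -
    have fx: "f x \<in> underS r (f y)"
      using that inj r_iff[of x y] by (auto simp: underS_def inj_eq)
    have sub: "underS r (f x) \<subseteq> underS r (f y)"
      using r fx unfolding well_order_on_def linear_order_on_def partial_order_on_def preorder_on_def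
      by (auto simp: underS_def dest: transD antisymD)
    have "f x \<in> Field (seg y)"
      using fx r_iff[of x x] by (auto simp: seg_def Field_def)
    then have "(Restr (seg y) (underS (seg y) (f x)), seg y) \<in> ordLess"
      by (intro underS_Restr_ordLess seg_wo) auto
    moreover have "Restr (seg y) (underS (seg y) (f x)) = seg x"
      using fx sub by (auto simp: seg_def underS_def)
    ultimately show ?thesis
      by simp
  qed
  define g where "g x = abs_ordinal (seg x)" for x
  have abs_less: "abs_ordinal p < abs_ordinal q" if "(p, q) \<in> ordLess" for p q :: "'a rel"
  proof -
    have wo: "Well_order p" "Well_order q"
      using that by (auto simp: ordLess_def)
    show ?thesis
      using that wo by (simp add: less_ordinal.abs_eq ordIso_reflexive)
  qed
  have g_mono: "g x < g y" if "x < y" for x y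
    unfolding g_def by (rule abs_less[OF seg_mono[OF that]])
  have g_ge: "x \<le> g x" for x
  proof (induction x rule: less_induct)
    case (less x)
    show ?case
    proof (rule ccontr)
      assume "\<not> x \<le> g x"
      then have "g x < x" by simp
      from less[OF this] g_mono[OF this] show False by simp
    qed
  qed
  have "g (abs_ordinal r) < abs_ordinal r"
    unfolding g_def by (rule abs_less[OF seg_less])
  with g_ge[of "abs_ordinal r"] show False by simp
qed


section \<open>Scattered spaces and the Cantor-Bendixson height\<close>

definition scattered_space :: "'a topology \<Rightarrow> bool" where
  "scattered_space X \<longleftrightarrow>
     (\<forall>S. S \<subseteq> topspace X \<and> S \<noteq> {} \<longrightarrow> (\<exists>x\<in>S. openin (subtopology X S) {x}))"

function CB_derivative :: "'a topology \<Rightarrow> 'o::wellorder \<Rightarrow> 'a set" where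
  "CB_derivative X \<alpha> =
     (if zero_ord \<alpha> then topspace X
      else if \<exists>\<beta>. succ_ord_of \<beta> \<alpha>
        then subtopology X (CB_derivative X (pred_ord \<alpha>)) derived_set_of CB_derivative X (pred_ord \<alpha>)
      else (\<Inter>\<beta>\<in>{..<\<alpha>}. CB_derivative X \<beta>))"
  by auto
termination
  by (relation "inv_image {(x, y). x < y} snd") (auto intro: wf_inv_image wf pred_ord_less)

declare CB_derivative.simps [simp del]

lemma CB_derivative_zero: "zero_ord \<alpha> \<Longrightarrow> CB_derivative X \<alpha> = topspace X"
  by (simp add: CB_derivative.simps)

lemma CB_derivative_succ:
  assumes "succ_ord_of \<beta> \<alpha>"
  shows "CB_derivative X \<alpha> = subtopology X (CB_derivative X \<beta>) derived_set_of CB_derivative X \<beta>"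
proof -
  have "\<not> zero_ord \<alpha>"
    using assms by (auto simp: zero_ord_def succ_ord_of_def not_le)
  then show ?thesis
    using assms by (auto simp: CB_derivative.simps[of X \<alpha>] pred_ord_eq)
qed

lemma CB_derivative_limit: "limit_ord \<alpha> \<Longrightarrow> CB_derivative X \<alpha> = (\<Inter>\<beta>\<in>{..<\<alpha>}. CB_derivative X \<beta>)"
  by (simp add: CB_derivative.simps[of X \<alpha>] limit_ord_def)

lemma CB_derivative_subset_derived:
  "\<alpha> < \<beta> \<Longrightarrow>
     CB_derivative X \<beta> \<subseteq> subtopology X (CB_derivative X \<alpha>) derived_set_of CB_derivative X \<alpha>"
proof (induction \<beta> rule: less_induct)
  case (less \<beta>)
  have nz: "\<not> zero_ord \<beta>"
    using less.prems by (auto simp: zero_ord_def not_le)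
  show ?case
  proof (cases "\<exists>\<gamma>. succ_ord_of \<gamma> \<beta>")
    case True
    then obtain \<gamma> where \<gamma>: "succ_ord_of \<gamma> \<beta>" by blast
    then have "\<gamma> < \<beta>" "\<alpha> \<le> \<gamma>"
      using less.prems by (auto simp: succ_ord_of_def not_le[symmetric])
    show ?thesis
    proof (cases "\<alpha> = \<gamma>")
      case True
      then show ?thesis using CB_derivative_succ[OF \<gamma>, of X] by simp
    next
      case False
      with \<open>\<alpha> \<le> \<gamma>\<close> have "\<alpha> < \<gamma>" by simp
      have "CB_derivative X \<beta> \<subseteq> CB_derivative X \<gamma>"
        unfolding CB_derivative_succ[OF \<gamma>] by (rule derived_set_of_subset_subtopology)
      with less.IH[OF \<open>\<gamma> < \<beta>\<close> \<open>\<alpha> < \<gamma>\<close>] show ?thesis by blast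
    qed
  next
    case False
    with nz have lim: "limit_ord \<beta>" by (simp add: limit_ord_def)
    from False less.prems obtain \<gamma> where \<gamma>: "\<alpha> < \<gamma>" "\<gamma> < \<beta>"
      by (auto simp: succ_ord_of_def not_le)
    have "CB_derivative X \<beta> \<subseteq> CB_derivative X \<gamma>"
      unfolding CB_derivative_limit[OF lim] using \<gamma> by auto
    with less.IH[OF \<gamma>(2,1)] show ?thesis by blast
  qed
qed

lemma CB_derivative_subset_topspace: "CB_derivative X \<alpha> \<subseteq> topspace X"
proof (cases "zero_ord \<alpha>")
  case True
  then show ?thesis by (simp add: CB_derivative_zero)
next
  case False
  then obtain \<beta> where "\<beta> < \<alpha>"
    by (auto simp: zero_ord_def not_le)
  from CB_derivative_subset_derived[OF this, of X] show ?thesis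
    by (auto simp: derived_set_of_subtopology in_derived_set_of)
qed

definition discrete_subspace :: "'a topology \<Rightarrow> 'a set \<Rightarrow> bool" where
  "discrete_subspace X S \<longleftrightarrow> subtopology X S = discrete_topology S"

definition CB_height :: "'a topology \<Rightarrow> 'a ordinal" where
  "CB_height X = (LEAST \<alpha>. discrete_subspace X (CB_derivative X \<alpha>))"

lemma scattered_imp_discrete_CB_derivative:
  fixes X :: "'a topology"
  assumes "scattered_space X"
  shows "\<exists>\<alpha> :: 'a ordinal. discrete_subspace X (CB_derivative X \<alpha>)"
proof (rule ccontr)
  assume nd: "\<not> ?thesis"
  have "\<exists>x \<in> CB_derivative X \<alpha>. openin (subtopology X (CB_derivative X \<alpha>)) {x}" for \<alpha> :: "'a ordinal"
  proof -
    have "CB_derivative X \<alpha> \<noteq> {}"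
    proof
      assume "CB_derivative X \<alpha> = {}"
      then have "discrete_subspace X (CB_derivative X \<alpha>)"
        by (simp add: discrete_subspace_def subtopology_eq_discrete_topology_eq)
      with nd show False by blast
    qed
    with assms show ?thesis
      using CB_derivative_subset_topspace[of X \<alpha>] by (auto simp: scattered_space_def)
  qed
  then obtain f where f: "\<And>\<alpha> :: 'a ordinal. f \<alpha> \<in> CB_derivative X \<alpha>"
      and iso: "\<And>\<alpha> :: 'a ordinal. openin (subtopology X (CB_derivative X \<alpha>)) {f \<alpha>}"
    by metis
  have neq: "f \<alpha> \<noteq> f \<beta>" if "\<alpha> < \<beta>" for \<alpha> \<beta> :: "'a ordinal"
  proof
    assume "f \<alpha> = f \<beta>"
    then have "f \<alpha> \<in> subtopology X (CB_derivative X \<alpha>) derived_set_of CB_derivative X \<alpha>"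
      using f[of \<beta>] CB_derivative_subset_derived[OF that, of X] by auto
    then show False
      using iso[of \<alpha>] by (auto simp: in_derived_set_of)
  qed
  have "inj f"
    by (rule injI) (metis neq less_linear)
  with not_inj_ordinal show False by blast
qed

lemma
  assumes "scattered_space X"
  shows discrete_CB_height: "discrete_subspace X (CB_derivative X (CB_height X))"
    and not_discrete_below_CB_height:
      "\<alpha> < CB_height X \<Longrightarrow> \<not> discrete_subspace X (CB_derivative X \<alpha>)"
  using LeastI_ex[OF scattered_imp_discrete_CB_derivative[OF assms]] not_less_Least
  unfolding CB_height_def by blast+


section \<open>IFS-attractors\<close>

definition contraction_on :: "'a set \<Rightarrow> ('a \<Rightarrow> 'a \<Rightarrow> real) \<Rightarrow> ('a \<Rightarrow> 'a) \<Rightarrow> bool" where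
  "contraction_on Y d f \<longleftrightarrow>
     f ` Y \<subseteq> Y \<and> (\<exists>\<alpha>. 0 < \<alpha> \<and> \<alpha> < 1 \<and> (\<forall>x\<in>Y. \<forall>y\<in>Y. d (f x) (f y) \<le> \<alpha> * d x y))"

definition weak_contraction_on :: "'a set \<Rightarrow> ('a \<Rightarrow> 'a \<Rightarrow> real) \<Rightarrow> ('a \<Rightarrow> 'a) \<Rightarrow> bool" where
  "weak_contraction_on Y d f \<longleftrightarrow>
     f ` Y \<subseteq> Y \<and> (\<forall>x\<in>Y. \<forall>y\<in>Y. x \<noteq> y \<longrightarrow> d (f x) (f y) < d x y)"

definition IFS_attractor :: "'a set \<Rightarrow> ('a \<Rightarrow> 'a \<Rightarrow> real) \<Rightarrow> bool" where
  "IFS_attractor Y d \<longleftrightarrow>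
     Metric_space Y d \<and> compact_space (Metric_space.mtopology Y d) \<and>
     (\<exists>(n::nat) f. (\<forall>i\<in>{1..n}. contraction_on Y d (f i)) \<and> Y = (\<Union>i\<in>{1..n}. f i ` Y))"

definition weak_IFS_attractor :: "'a set \<Rightarrow> ('a \<Rightarrow> 'a \<Rightarrow> real) \<Rightarrow> bool" where
  "weak_IFS_attractor Y d \<longleftrightarrow>
     Metric_space Y d \<and> compact_space (Metric_space.mtopology Y d) \<and>
     (\<exists>(n::nat) f. (\<forall>i\<in>{1..n}. weak_contraction_on Y d (f i)) \<and> Y = (\<Union>i\<in>{1..n}. f i ` Y))"

text \<open>
  A definition cannot quantify over the type of the points of the attractor. It is no restriction to
  take them from the same type as those of the space: see \<open>topological_IFS_attractorI\<close>.
\<close>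

definition topological_IFS_attractor :: "'a topology \<Rightarrow> bool" where
  "topological_IFS_attractor X \<longleftrightarrow>
     (\<exists>(Y :: 'a set) d. IFS_attractor Y d \<and> X homeomorphic_space Metric_space.mtopology Y d)"

lemma topological_IFS_attractorI:
  fixes X :: "'a topology" and Y :: "'b set"
  assumes "IFS_attractor Y d" and "X homeomorphic_space Metric_space.mtopology Y d"
  shows "topological_IFS_attractor X"
proof -
  interpret Y: Metric_space Y d
    using assms(1) by (simp add: IFS_attractor_def)
  obtain n F where F: "\<And>i. i \<in> {1..n::nat} \<Longrightarrow> contraction_on Y d (F i)"
      and Y_eq: "Y = (\<Union>i\<in>{1..n}. F i ` Y)" and cpt: "compact_space Y.mtopology"
    using assms(1) unfolding IFS_attractor_def by blast
  obtain h k where "homeomorphic_maps X Y.mtopology h k"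
    using assms(2) unfolding homeomorphic_space_def by blast
  define M where "M = topspace X"
  have kh: "\<And>x. x \<in> M \<Longrightarrow> k (h x) = x" and hk: "\<And>y. y \<in> Y \<Longrightarrow> h (k y) = y"
    and h: "\<And>x. x \<in> M \<Longrightarrow> h x \<in> Y" and k: "\<And>y. y \<in> Y \<Longrightarrow> k y \<in> M"
    using \<open>homeomorphic_maps X Y.mtopology h k\<close>
    by (auto simp: homeomorphic_maps_def M_def continuous_map_def)
  define e where "e x y = d (h x) (h y)" for x y
  interpret M: Metric_space M e
  proof
    show "0 \<le> e x y" "e x y = e y x" for x y
      by (auto simp: e_def Y.commute)
    show "e x y = 0 \<longleftrightarrow> x = y" if "x \<in> M" "y \<in> M" for x y
      using that h kh by (metis Y.zero e_def)
    show "e x z \<le> e x y + e y z" if "x \<in> M" "y \<in> M" "z \<in> M" for x y z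
      using that h by (simp add: e_def Y.triangle)
  qed
  have ek: "e (k x) (k y) = d x y" if "x \<in> Y" "y \<in> Y" for x y
    using that by (simp add: e_def hk)
  have "continuous_map M.mtopology Y.mtopology h"
    unfolding Metric_space.metric_continuous_map[OF M.Metric_space_axioms Y.Metric_space_axioms]
    using h by (auto simp: e_def)
  moreover have "continuous_map Y.mtopology M.mtopology k"
    unfolding Metric_space.metric_continuous_map[OF Y.Metric_space_axioms M.Metric_space_axioms]
    using k ek by auto
  ultimately have "homeomorphic_maps M.mtopology Y.mtopology h k"
    using kh hk by (auto simp: homeomorphic_maps_def)
  then have MY: "M.mtopology homeomorphic_space Y.mtopology"
    unfolding homeomorphic_space_def by blast
  define G where "G i = k \<circ> F i \<circ> h" for i
  have "contraction_on M e (G i)" if "i \<in> {1..n}" for i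
  proof -
    from F[OF that] obtain a where a: "0 < a" "a < 1" and FY: "F i ` Y \<subseteq> Y"
        and Fa: "\<forall>x\<in>Y. \<forall>y\<in>Y. d (F i x) (F i y) \<le> a * d x y"
      by (auto simp: contraction_on_def)
    have "G i ` M \<subseteq> M"
      using FY h k by (auto simp: G_def)
    moreover have "e (G i x) (G i y) \<le> a * e x y" if "x \<in> M" "y \<in> M" for x y
    proof -
      have "F i (h x) \<in> Y" "F i (h y) \<in> Y"
        using FY h that by auto
      then show ?thesis
        using Fa h that by (simp add: G_def ek) (simp add: e_def)
    qed
    ultimately show ?thesis
      using a unfolding contraction_on_def by blast
  qed
  moreover have "M = (\<Union>i\<in>{1..n}. G i ` M)"
  proof -
    have hM: "h ` M = Y" and kY: "k ` Y = M"
      using h k hk kh by (auto simp: image_iff) (metis hk k, metis kh h)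
    have "(\<Union>i\<in>{1..n}. G i ` M) = (\<Union>i\<in>{1..n}. k ` (F i ` Y))"
      unfolding G_def image_comp[symmetric] hM ..
    also have "\<dots> = k ` (\<Union>i\<in>{1..n}. F i ` Y)"
      by blast
    also have "\<dots> = M"
      using Y_eq kY by simp
    finally show ?thesis ..
  qed
  moreover have "compact_space M.mtopology"
    using cpt MY homeomorphic_compact_space by blast
  ultimately have "IFS_attractor M e"
    unfolding IFS_attractor_def using M.Metric_space_axioms by blast
  moreover have "X homeomorphic_space M.mtopology"
    using assms(2) MY homeomorphic_space_sym homeomorphic_space_trans by blast
  ultimately show ?thesis
    unfolding topological_IFS_attractor_def by blast
qed

end

theory Submission
  imports Defs
begin

text \<open>
  The argument looks at an attractor \<open>Y\<close> of weak contractions \<open>f\<^sub>i\<close> whose derivatives \<open>Y\<^bsup>(\<beta>)\<^esup>\<close>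
  are infinite for \<open>\<beta> < \<kappa>\<close> and whose derivative \<open>K = Y\<^bsup>(\<kappa>)\<^esup>\<close> is finite, \<open>\<kappa>\<close> being a limit. For a
  compact Hausdorff space this is what having height \<open>\<kappa>\<close> means, because a closed subspace is
  discrete if and only if it is finite. By compactness \<open>K\<close> is nonempty.

  Suppose first that every \<open>f\<^sub>i\<close> maps \<open>K\<close> into \<open>K\<close>. For any \<open>\<gamma> < \<kappa>\<close>, pick a point \<open>z\<close> of the
  infinite compact set \<open>Y\<^bsup>(\<gamma>)\<^esup>\<close> at maximal distance from \<open>K\<close>. Continuous maps between compact
  Hausdorff spaces cannot create Cantor-Bendixson rank (\<open>CB_derivative_finite_cover\<close>), so
  \<open>z = f\<^sub>i w\<close> for some \<open>w\<close> in \<open>Y\<^bsup>(\<gamma>)\<^esup>\<close>. If \<open>q\<close> is a point of \<open>K\<close> nearest to \<open>w\<close>, then \<open>z\<close> is at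
  distance at most \<open>d z (f\<^sub>i q) < d w q\<close> from \<open>K\<close>, so \<open>w\<close> is farther from \<open>K\<close> than \<open>z\<close> is, a
  contradiction.

  In general some \<open>f\<^sub>i\<close> may move a point \<open>p\<close> of \<open>K\<close> out of \<open>K\<close>. Divide \<open>Y\<close> into the finitely many
  closed cells of points for which \<open>p\<close> is a nearest point of \<open>K\<close>. The cell of \<open>p\<close> has at most the
  one point \<open>p\<close> of rank \<open>\<kappa>\<close>, so the only point of its image under \<open>f\<^sub>i\<close> that could have rank
  \<open>\<kappa>\<close> in this image is \<open>f\<^sub>i p\<close>. When \<open>f\<^sub>i p\<close> is outside \<open>K\<close>, the \<open>\<kappa>\<close>-th derivative of the image is
  therefore empty, and since \<open>\<kappa>\<close> is a limit, compactness makes already an earlier derivative empty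
  (\<open>CB_derivative_empty_below_limit\<close>). There are finitely many such pairs \<open>(i, p)\<close>, so one
  \<open>\<gamma> < \<kappa>\<close> serves them all. For this \<open>\<gamma>\<close> the point \<open>z\<close> lies in the image of a cell whose centre
  stays in \<open>K\<close>, and the previous paragraph applies.
\<close>

section \<open>Cantor-Bendixson derivatives of compact Hausdorff spaces\<close>

lemma ordinal_cases:
  obtains (zero) "zero_ord \<alpha>" | (succ) \<beta> where "succ_ord_of \<beta> \<alpha>" | (limit) "limit_ord \<alpha>"
  unfolding limit_ord_def by blast

lemma limit_ord_lessThan_nonempty: "limit_ord \<kappa> \<Longrightarrow> {..<\<kappa>} \<noteq> {}"
  by (auto simp: limit_ord_def zero_ord_def not_le)

lemma finite_bounded_below_limit:
  assumes "limit_ord \<kappa>" "finite B" "B \<subseteq> {..<\<kappa>}"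
  obtains \<mu> where "\<mu> < \<kappa>" "\<And>\<beta>. \<beta> \<in> B \<Longrightarrow> \<beta> \<le> \<mu>"
proof -
  obtain \<beta> where \<beta>: "\<beta> < \<kappa>"
    using limit_ord_lessThan_nonempty[OF assms(1)] by blast
  have "Max (insert \<beta> B) \<in> insert \<beta> B"
    using assms(2) by (intro Max_in) auto
  then have "Max (insert \<beta> B) < \<kappa>"
    using assms(3) \<beta> by auto
  moreover have "\<gamma> \<le> Max (insert \<beta> B)" if "\<gamma> \<in> B" for \<gamma>
    using assms(2) that by simp
  ultimately show thesis
    using that by blast
qed

lemma CB_derivative_antimono: "\<alpha> \<le> \<beta> \<Longrightarrow> CB_derivative T \<beta> \<subseteq> CB_derivative T \<alpha>"
  using CB_derivative_subset_derived[of \<alpha> \<beta> T] derived_set_of_subset_subtopology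
  by (cases "\<alpha> = \<beta>") fastforce+

lemma closedin_CB_derivative:
  assumes "Hausdorff_space T"
  shows "closedin T (CB_derivative T \<alpha>)"
proof (induction \<alpha> rule: less_induct)
  case (less \<alpha>)
  show ?case
  proof (cases \<alpha> rule: ordinal_cases)
    case zero
    then show ?thesis by (simp add: CB_derivative_zero)
  next
    case (succ \<beta>)
    then have "closedin T (CB_derivative T \<beta>)"
      using less by (simp add: succ_ord_of_def)
    then show ?thesis
      using assms
      by (simp add: CB_derivative_succ[OF succ] derived_set_of_subtopology
          closedin_Int closedin_derived_set_of)
  next
    case limit
    then show ?thesis
      unfolding CB_derivative_limit[OF limit]
      using less limit_ord_lessThan_nonempty[OF limit] by (intro closedin_Inter) auto
  qed
qed

lemma CB_derivative_succ_Hausdorff: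
  assumes "Hausdorff_space T" and "succ_ord_of \<beta> \<alpha>"
  shows "CB_derivative T \<alpha> = T derived_set_of CB_derivative T \<beta>"
  using closedin_CB_derivative[OF assms(1), of \<beta>]
  by (auto simp: CB_derivative_succ[OF assms(2)] derived_set_of_subtopology
      closedin_contains_derived_set)

lemma CB_derivative_subtopology_mono:
  "CB_derivative (subtopology T S) \<alpha> \<subseteq> CB_derivative T \<alpha>"
proof (induction \<alpha> rule: less_induct)
  case (less \<alpha>)
  show ?case
  proof (cases \<alpha> rule: ordinal_cases)
    case zero
    then show ?thesis by (simp add: CB_derivative_zero)
  next
    case (succ \<beta>)
    then have "CB_derivative (subtopology T S) \<beta> \<subseteq> CB_derivative T \<beta>"
      using less by (simp add: succ_ord_of_def)
    then show ?thesis
      unfolding CB_derivative_succ[OF succ] by (fastforce simp: derived_set_of_subtopology in_derived_set_of)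
  next
    case limit
    then show ?thesis
      unfolding CB_derivative_limit[OF limit] using less by blast
  qed
qed

text \<open>
  Limit ordinals enter the proof through this form of compactness: closed sets that decrease in a
  compact space cannot become empty at a limit stage for the first time. At a successor stage derivatives
  can, and there are indeed attractors of successor height.
\<close>
lemma nested_closed_empty_below_limit:
  fixes \<kappa> :: "'o::wellorder"
  assumes "compact_space T" and "limit_ord \<kappa>"
    and closed: "\<And>\<beta>. \<beta> < \<kappa> \<Longrightarrow> closedin T (C \<beta>)"
    and antimono: "\<And>\<beta> \<gamma>. \<beta> \<le> \<gamma> \<Longrightarrow> \<gamma> < \<kappa> \<Longrightarrow> C \<gamma> \<subseteq> C \<beta>"
    and empty: "(\<Inter>\<beta>\<in>{..<\<kappa>}. C \<beta>) = {}"
  shows "\<exists>\<beta><\<kappa>. C \<beta> = {}"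
proof -
  have "\<forall>D \<in> C ` {..<\<kappa>}. closedin T D"
    using closed by blast
  then obtain F where F: "finite F" "F \<subseteq> C ` {..<\<kappa>}" "\<Inter>F = {}"
    using assms(1) empty unfolding compact_space_fip by meson
  then obtain B where B: "finite B" "B \<subseteq> {..<\<kappa>}" "F = C ` B"
    by (meson finite_subset_image)
  obtain m where m: "m < \<kappa>" "\<And>\<beta>. \<beta> \<in> B \<Longrightarrow> \<beta> \<le> m"
    using finite_bounded_below_limit[OF assms(2) B(1,2)] by blast
  have "C m \<subseteq> C \<beta>" if "\<beta> \<in> B" for \<beta>
    using antimono m that by blast
  then have "C m \<subseteq> \<Inter>F"
    using B(3) by blast
  then show ?thesis
    using F m(1) by blast
qed

lemma CB_derivative_empty_below_limit:
  assumes "compact_space T" "Hausdorff_space T" "limit_ord \<kappa>" "CB_derivative T \<kappa> = {}"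
  shows "\<exists>\<beta><\<kappa>. CB_derivative T \<beta> = {}"
  using assms
  by (intro nested_closed_empty_below_limit[of T] closedin_CB_derivative CB_derivative_antimono)
    (simp_all add: CB_derivative_limit)

text \<open>
  An accumulation point \<open>y\<close> of the image is approached by image points other than \<open>y\<close>, hence by
  images of points outside the fibre of \<open>y\<close>. As \<open>f\<close> is a closed map, these points accumulate
  somewhere on the fibre, and a limit point found there is an accumulation point because the points
  approaching it avoid the fibre altogether.
\<close>
lemma derived_set_of_image_subset:
  assumes "compact_space T" "Hausdorff_space U" "continuous_map T U f" "closedin T D"
  shows "U derived_set_of (f ` D) \<subseteq> f ` (T derived_set_of D)"
proof
  fix y assume y: "y \<in> U derived_set_of (f ` D)"
  define E where "E = {x \<in> D. f x \<noteq> y}"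
  have E: "E \<subseteq> D" "E \<subseteq> topspace T"
    using closedin_subset[OF assms(4)] by (auto simp: E_def)
  have "y \<in> U closure_of (f ` E)"
    using y by (fastforce simp: in_derived_set_of in_closure_of E_def)
  then have "y \<in> f ` (T closure_of E)"
    using continuous_imp_closed_map[OF assms(3,1,2)] E(2)
    unfolding closed_map_closure_of_image by blast
  then obtain x where x: "x \<in> T closure_of E" "f x = y" by blast
  then have "x \<in> T derived_set_of D"
    using E(1) by (fastforce simp: in_derived_set_of in_closure_of E_def)
  with x show "y \<in> f ` (T derived_set_of D)" by blast
qed

text \<open>
  Rank does not increase along continuous maps between compact Hausdorff spaces, even if finitely
  many maps share the work of covering the target. At a limit stage, a point \<open>y\<close> whose fibres in
  all the \<open>T j\<close> missed the limit derivative would, by compactness, have fibres that miss some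
  earlier derivative, and finitely many stages below a limit have a common bound below it.
  A single surjection is one instance, a finite cover by closed subspaces is another.
\<close>
lemma CB_derivative_finite_cover:
  fixes \<alpha> :: "'o::wellorder"
  assumes "finite J" "Hausdorff_space U"
    and T: "\<And>j. j \<in> J \<Longrightarrow> compact_space (T j) \<and> Hausdorff_space (T j)"
    and f: "\<And>j. j \<in> J \<Longrightarrow> continuous_map (T j) U (f j)"
    and cover: "topspace U \<subseteq> (\<Union>j\<in>J. f j ` topspace (T j))"
  shows "CB_derivative U \<alpha> \<subseteq> (\<Union>j\<in>J. f j ` CB_derivative (T j) \<alpha>)"
proof (induction \<alpha> rule: less_induct)
  case (less \<alpha>)
  show ?case
  proof (cases \<alpha> rule: ordinal_cases)
    case zero
    then show ?thesis using cover by (simp add: CB_derivative_zero)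
  next
    case (succ \<beta>)
    then have "CB_derivative U \<beta> \<subseteq> (\<Union>j\<in>J. f j ` CB_derivative (T j) \<beta>)"
      using less by (simp add: succ_ord_of_def)
    then have "CB_derivative U \<alpha> \<subseteq> U derived_set_of (\<Union>j\<in>J. f j ` CB_derivative (T j) \<beta>)"
      unfolding CB_derivative_succ_Hausdorff[OF assms(2) succ] by (rule derived_set_of_mono)
    also have "\<dots> = (\<Union>j\<in>J. U derived_set_of (f j ` CB_derivative (T j) \<beta>))"
      using derived_set_of_Union[of "(\<lambda>j. f j ` CB_derivative (T j) \<beta>) ` J" U] assms(1) by simp
    also have "\<dots> \<subseteq> (\<Union>j\<in>J. f j ` CB_derivative (T j) \<alpha>)"
    proof (rule UN_mono)
      fix j assume "j \<in> J"
      with T f have "compact_space (T j)" "Hausdorff_space (T j)" "continuous_map (T j) U (f j)"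
        by blast+
      then show "U derived_set_of (f j ` CB_derivative (T j) \<beta>) \<subseteq> f j ` CB_derivative (T j) \<alpha>"
        using derived_set_of_image_subset[OF _ assms(2)] closedin_CB_derivative
        by (metis CB_derivative_succ_Hausdorff[OF _ succ])
    qed simp
    finally show ?thesis .
  next
    case limit
    show ?thesis
    proof (rule ccontr)
      assume "\<not> ?thesis"
      then obtain y where y: "y \<in> CB_derivative U \<alpha>"
          "\<And>j. j \<in> J \<Longrightarrow> y \<notin> f j ` CB_derivative (T j) \<alpha>"
        by blast
      define C where "C j \<beta> = {x \<in> CB_derivative (T j) \<beta>. f j x = y}" for j and \<beta> :: 'o
      have "\<exists>\<beta><\<alpha>. C j \<beta> = {}" if j: "j \<in> J" for j
      proof (rule nested_closed_empty_below_limit[OF _ limit])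
        show "compact_space (T j)" using T j by blast
        have y': "closedin U {y}"
          using y(1) CB_derivative_subset_topspace assms(2)
          by (metis closedin_Hausdorff_sing_eq subsetD)
        show "closedin (T j) (C j \<beta>)" for \<beta>
          using closedin_continuous_map_preimage_gen[OF f[OF j] closedin_CB_derivative y']
            T[OF j] by (simp add: C_def)
        show "C j \<gamma> \<subseteq> C j \<beta>" if "\<beta> \<le> \<gamma>" for \<beta> \<gamma>
          using CB_derivative_antimono[OF that, of "T j"] by (auto simp: C_def)
        show "(\<Inter>\<beta>\<in>{..<\<alpha>}. C j \<beta>) = {}"
        proof -
          have "{..<\<alpha>} \<noteq> {}"
            using limit by (rule limit_ord_lessThan_nonempty)
          then show ?thesis
            using y(2)[OF j] by (auto simp: C_def CB_derivative_limit[OF limit])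
        qed
      qed
      then obtain b where b: "\<And>j. j \<in> J \<Longrightarrow> b j < \<alpha> \<and> C j (b j) = {}"
        by metis
      obtain m where m: "m < \<alpha>" "\<And>\<beta>. \<beta> \<in> b ` J \<Longrightarrow> \<beta> \<le> m"
        using finite_bounded_below_limit[OF limit, of "b ` J"] assms(1) b by blast
      then have "y \<in> CB_derivative U m"
        using y(1) m(1) CB_derivative_antimono[of m \<alpha> U] by (meson less_imp_le subsetD)
      then obtain j where j: "j \<in> J" "C j m \<noteq> {}"
        using less[OF m(1)] by (fastforce simp: C_def)
      have "b j \<le> m"
        using j m(2) by blast
      then show False
        using CB_derivative_antimono[of "b j" m "T j"] b[OF j(1)] j(2) by (auto simp: C_def)
    qed
  qed
qed

lemma CB_derivative_image_subset:
  assumes "compact_space T" "Hausdorff_space T" "Hausdorff_space U" "continuous_map T U f"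
    and "f ` topspace T = topspace U"
  shows "CB_derivative U \<alpha> \<subseteq> f ` CB_derivative T \<alpha>"
  using CB_derivative_finite_cover[of "{()}" U "\<lambda>_. T" "\<lambda>_. f"] assms by simp

lemma compact_discrete_subspace_iff_finite:
  assumes "compact_space T" "Hausdorff_space T" "closedin T S"
  shows "discrete_subspace T S \<longleftrightarrow> finite S"
proof
  assume "discrete_subspace T S"
  moreover have "compact_space (subtopology T S)"
    using assms closedin_compact_space compact_space_subtopology by blast
  ultimately show "finite S"
    by (simp add: discrete_subspace_def compact_space_discrete_topology)
next
  assume "finite S"
  then show "discrete_subspace T S"
    using assms closedin_subset
    by (simp add: discrete_subspace_def subtopology_eq_discrete_topology_eq derived_set_of_finite)
qed


section \<open>Finite families of weak contractions\<close>

context Metric_space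
begin

lemma continuous_map_dist_point:
  assumes "p \<in> M"
  shows "continuous_map mtopology euclideanreal (\<lambda>x. d x p)"
proof -
  have "continuous_map mtopology Met_TC.mtopology (\<lambda>x. d x p)"
    unfolding metric_continuous_map[OF Met_TC.Metric_space_axioms]
  proof (intro conjI ballI allI impI)
    fix a \<epsilon> :: _ assume a: "a \<in> M" and "\<epsilon> > (0::real)"
    moreover have "dist (d a p) (d x p) \<le> d a x" if "x \<in> M" for x
      using triangle[of a x p] triangle[of x a p] a that assms commute[of a x]
      by (auto simp: dist_real_def)
    ultimately show "\<exists>\<delta>>0. \<forall>x. x \<in> M \<and> d a x < \<delta> \<longrightarrow> dist (d a p) (d x p) < \<epsilon>"
      by (meson le_less_trans)
  qed simp
  then show ?thesis by simp
qed

lemma continuous_map_weak_contraction: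
  assumes "weak_contraction_on M d f"
  shows "continuous_map mtopology mtopology f"
  unfolding metric_continuous_map[OF Metric_space_axioms]
proof (intro conjI ballI allI impI)
  show "f ` M \<subseteq> M"
    using assms by (simp add: weak_contraction_on_def)
  fix a \<epsilon> assume a: "a \<in> M" and "\<epsilon> > (0::real)"
  moreover have "d (f a) (f x) \<le> d a x" if "x \<in> M" for x
    using assms a that by (cases "a = x") (auto simp: weak_contraction_on_def less_imp_le)
  ultimately show "\<exists>\<delta>>0. \<forall>x. x \<in> M \<and> d a x < \<delta> \<longrightarrow> d (f a) (f x) < \<epsilon>"
    by (meson le_less_trans)
qed

text \<open>The closed Voronoi cell of \<open>p\<close> with respect to the set of sites \<open>K\<close>.\<close>
definition nearest_cell :: "'a set \<Rightarrow> 'a \<Rightarrow> 'a set" where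
  "nearest_cell K p = {x \<in> M. \<forall>q\<in>K. d x p \<le> d x q}"

lemma closedin_nearest_cell:
  assumes "K \<subseteq> M" "p \<in> M"
  shows "closedin mtopology (nearest_cell K p)"
proof -
  have "closedin mtopology {x \<in> topspace mtopology. d x p - d x q \<in> {..0}}" if "q \<in> K" for q
    using assms that
    by (intro closedin_continuous_map_preimage[where Y = euclideanreal] continuous_map_diff
        continuous_map_dist_point) auto
  then have "closedin mtopology {x \<in> M. d x p \<le> d x q}" if "q \<in> K" for q
    using that by simp
  moreover have "closedin mtopology M"
    using closedin_topspace[of mtopology] by simp
  ultimately have "closedin mtopology (\<Inter>(insert M ((\<lambda>q. {x \<in> M. d x p \<le> d x q}) ` K)))"
    by (intro closedin_Inter) blast+
  moreover have "\<Inter>(insert M ((\<lambda>q. {x \<in> M. d x p \<le> d x q}) ` K)) = nearest_cell K p"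
    by (auto simp: nearest_cell_def)
  ultimately show ?thesis by simp
qed

lemma nearest_cells_cover:
  assumes "finite K" "K \<noteq> {}" "x \<in> M"
  shows "\<exists>p\<in>K. x \<in> nearest_cell K p"
proof -
  have "\<exists>p\<in>K. \<forall>q\<in>K. d x p \<le> d x q"
    using ex_is_arg_min_if_finite[OF assms(1,2), of "d x"] by (auto simp: is_arg_min_linorder)
  then show ?thesis
    using assms(3) by (auto simp: nearest_cell_def)
qed

lemma nearest_cell_Int:
  assumes "K \<subseteq> M" "p \<in> K"
  shows "nearest_cell K p \<inter> K \<subseteq> {p}"
proof
  fix q assume q: "q \<in> nearest_cell K p \<inter> K"
  then have "d q p \<le> d q q"
    by (auto simp: nearest_cell_def)
  then show "q \<in> {p}"
    using q assms by (metis IntD2 nonneg order_antisym singletonI subsetD zero)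
qed

end

text \<open>
  The hypotheses on the derivatives speak of cardinalities only, so that they pass through
  homeomorphisms, and the ordinals range over an arbitrary well-ordered type: the height of a space
  is an ordinal over the type of its points, while the attractor may live in another type.
\<close>
lemma not_weak_IFS_attractor_limit_derivative:
  fixes \<kappa> :: "'o::wellorder"
  assumes attractor: "weak_IFS_attractor Y d"
    and \<kappa>: "limit_ord \<kappa>"
    and fin: "finite (CB_derivative (Metric_space.mtopology Y d) \<kappa>)"
    and inf: "\<And>\<beta>. \<beta> < \<kappa> \<Longrightarrow> infinite (CB_derivative (Metric_space.mtopology Y d) \<beta>)"
  shows False
proof -
  interpret Metric_space Y d
    using attractor by (simp add: weak_IFS_attractor_def)
  let ?T = "mtopology"
  obtain n f where cpt: "compact_space ?T"
      and f: "\<And>i. i \<in> {1..n::nat} \<Longrightarrow> weak_contraction_on Y d (f i)"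
      and Y: "Y = (\<Union>i\<in>{1..n}. f i ` Y)"
    using attractor unfolding weak_IFS_attractor_def by blast
  note H = Hausdorff_space_mtopology
  define K where "K = CB_derivative ?T \<kappa>"
  have K: "finite K" "K \<subseteq> Y"
    using fin CB_derivative_subset_topspace[of ?T \<kappa>] by (auto simp: K_def)
  have "K \<noteq> {}"
    using CB_derivative_empty_below_limit[OF cpt H \<kappa>] inf by (fastforce simp: K_def)
  define C where "C = nearest_cell K"
  have C: "closedin ?T (C p)" "C p \<subseteq> Y" if "p \<in> K" for p
    using closedin_nearest_cell[of K p] K that by (auto simp: C_def nearest_cell_def)
  define J where "J = {1..n} \<times> K"
  define A where "A = (\<lambda>(i, p). f i ` C p)"
  have "finite J"
    using K by (simp add: J_def)
  have cell: "compact_space (subtopology ?T (C p))" "Hausdorff_space (subtopology ?T (C p))"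
    if "p \<in> K" for p
    using C[OF that] cpt H closedin_compact_space compact_space_subtopology
      Hausdorff_space_subtopology by blast+
  have f_cont: "continuous_map (subtopology ?T (C p)) (subtopology ?T (A (i, p))) (f i)"
    if "(i, p) \<in> J" for i p
    using that continuous_map_weak_contraction[OF f, of i]
    by (auto simp: J_def A_def continuous_map_in_subtopology
        intro: continuous_map_from_subtopology)
  have A: "compact_space (subtopology ?T (A j))" "Hausdorff_space (subtopology ?T (A j))"
      "A j \<subseteq> Y" if j: "j \<in> J" for j
  proof -
    obtain i p where ip: "j = (i, p)" "i \<in> {1..n}" "p \<in> K"
      using j by (auto simp: J_def)
    have "compactin ?T (A j)"
      unfolding ip(1) A_def prod.case
      using C[OF ip(3)] cpt closedin_compact_space f[OF ip(2)]
      by (intro image_compactin[of ?T] continuous_map_weak_contraction)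
    then show "compact_space (subtopology ?T (A j))" "A j \<subseteq> Y"
      using compact_space_subtopology compactin_subset_topspace by fastforce+
    show "Hausdorff_space (subtopology ?T (A j))"
      using H Hausdorff_space_subtopology by blast
  qed
  have A_sub: "CB_derivative (subtopology ?T (A (i, p))) \<beta>
      \<subseteq> f i ` CB_derivative (subtopology ?T (C p)) \<beta>" if "(i, p) \<in> J" for i p and \<beta> :: 'o
  proof (rule CB_derivative_image_subset)
    show "f i ` topspace (subtopology ?T (C p)) = topspace (subtopology ?T (A (i, p)))"
      using that A(3)[OF that] C(2)[of p] by (auto simp: A_def J_def Int_absorb1)
  qed (use that f_cont A cell in \<open>auto simp: J_def\<close>)
  have cover: "CB_derivative ?T \<beta> \<subseteq> (\<Union>j\<in>J. CB_derivative (subtopology ?T (A j)) \<beta>)" for \<beta> :: 'o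
  proof -
    have "topspace ?T \<subseteq> (\<Union>j\<in>J. (\<lambda>x. x) ` topspace (subtopology ?T (A j)))"
    proof
      fix y assume "y \<in> topspace ?T"
      then have "y \<in> (\<Union>i\<in>{1..n}. f i ` Y)"
        using Y by simp
      then obtain i x where ix: "i \<in> {1..n}" "x \<in> Y" "y = f i x"
        by blast
      obtain p where "p \<in> K" "x \<in> C p"
        using nearest_cells_cover[OF K(1) \<open>K \<noteq> {}\<close> ix(2)] by (auto simp: C_def)
      then have "(i, p) \<in> J" "y \<in> A (i, p)"
        using ix by (auto simp: J_def A_def)
      then show "y \<in> (\<Union>j\<in>J. (\<lambda>x. x) ` topspace (subtopology ?T (A j)))"
        using \<open>y \<in> topspace ?T\<close> by (auto intro!: bexI[of _ "(i, p)"])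
    qed
    then show ?thesis
      using CB_derivative_finite_cover[OF \<open>finite J\<close> H, of "\<lambda>j. subtopology ?T (A j)" "\<lambda>_ x. x" \<beta>] A
      by (simp add: continuous_map_from_subtopology)
  qed
  \<comment> \<open>If the centre of a cell leaves \<open>K\<close>, the image of the cell has rank below \<open>\<kappa>\<close>.\<close>
  have "\<exists>\<beta><\<kappa>. CB_derivative (subtopology ?T (A (i, p))) \<beta> = {}"
    if ip: "(i, p) \<in> J" "f i p \<notin> K" for i p
  proof (rule CB_derivative_empty_below_limit[OF A(1,2)[OF ip(1)] \<kappa>])
    have "CB_derivative (subtopology ?T (C p)) \<kappa> \<subseteq> C p \<inter> K"
      using CB_derivative_subtopology_mono[of ?T "C p" \<kappa>]
        CB_derivative_subset_topspace[of "subtopology ?T (C p)" \<kappa>] by (auto simp: K_def)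
    then have "CB_derivative (subtopology ?T (C p)) \<kappa> \<subseteq> {p}"
      using nearest_cell_Int[OF K(2)] ip by (auto simp: C_def J_def)
    then have "CB_derivative (subtopology ?T (A (i, p))) \<kappa> \<subseteq> {f i p}"
      using A_sub[OF ip(1), of \<kappa>] by blast
    moreover have "CB_derivative (subtopology ?T (A (i, p))) \<kappa> \<subseteq> K"
      unfolding K_def by (rule CB_derivative_subtopology_mono)
    ultimately show "CB_derivative (subtopology ?T (A (i, p))) \<kappa> = {}"
      using ip(2) by blast
  qed
  then obtain b where b: "\<And>i p. (i, p) \<in> J \<Longrightarrow> f i p \<notin> K \<Longrightarrow>
      b i p < \<kappa> \<and> CB_derivative (subtopology ?T (A (i, p))) (b i p) = {}"
    by metis
  define B where "B = (\<lambda>(i, p). b i p) ` {(i, p) \<in> J. f i p \<notin> K}"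
  have "finite B" "B \<subseteq> {..<\<kappa>}"
    using \<open>finite J\<close> b by (auto simp: B_def intro: finite_subset)
  then obtain \<gamma> where \<gamma>: "\<gamma> < \<kappa>" "\<And>\<beta>. \<beta> \<in> B \<Longrightarrow> \<beta> \<le> \<gamma>"
    using finite_bounded_below_limit[OF \<kappa>] by blast
  have good: "f i p \<in> K"
    if ip: "(i, p) \<in> J" "CB_derivative (subtopology ?T (A (i, p))) \<gamma> \<noteq> {}" for i p
  proof (rule ccontr)
    assume bad: "f i p \<notin> K"
    then have "b i p \<in> B"
      using ip by (auto simp: B_def)
    then have "b i p \<le> \<gamma>"
      by (rule \<gamma>(2))
    from CB_derivative_antimono[OF this, of "subtopology ?T (A (i, p))"] show False
      using b[OF ip(1) bad] ip(2) by simp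
  qed
  \<comment> \<open>\<open>R\<close> is the set of distances to \<open>K\<close> of the points of rank at least \<open>\<gamma>\<close>. Written as a union
    over the cells, it is compact by continuity of the distance to a single point.\<close>
  define D where "D p = C p \<inter> CB_derivative ?T \<gamma>" for p
  define R where "R = (\<Union>p\<in>K. (\<lambda>x. d x p) ` D p)"
  have "compact ((\<lambda>x. d x p) ` D p)" if p: "p \<in> K" for p
  proof -
    have "compactin ?T (D p)"
      unfolding D_def using C[OF p] closedin_CB_derivative[OF H] cpt
      by (intro closedin_compact_space closedin_Int)
    then show ?thesis
      using image_compactin[OF _ continuous_map_dist_point] p K(2) by fastforce
  qed
  then have "compact R"
    unfolding R_def using K(1) by (intro compact_UN)
  obtain z0 where z0: "z0 \<in> CB_derivative ?T \<gamma>" "z0 \<notin> K"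
    using inf[OF \<gamma>(1)] K(1) by (meson finite_subset subsetI)
  have "z0 \<in> Y"
    using z0 CB_derivative_subset_topspace by fastforce
  then obtain p0 where p0: "p0 \<in> K" "z0 \<in> C p0"
    using nearest_cells_cover[OF K(1) \<open>K \<noteq> {}\<close>] by (auto simp: C_def)
  then have "d z0 p0 \<in> R"
    using z0 by (auto simp: R_def D_def)
  then obtain r where r: "r \<in> R" "\<And>s. s \<in> R \<Longrightarrow> s \<le> r"
    using compact_attains_sup[OF \<open>compact R\<close>] by blast
  have "0 < d z0 p0"
    using \<open>z0 \<in> Y\<close> p0 z0(2) K(2) by (metis mdist_pos_less subsetD)
  then have "0 < r"
    using r(2)[OF \<open>d z0 p0 \<in> R\<close>] by simp
  obtain p z where pz: "p \<in> K" "z \<in> C p" "z \<in> CB_derivative ?T \<gamma>" "r = d z p"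
    using r(1) by (auto simp: R_def D_def)
  have "z \<noteq> p"
    using pz(1,4) \<open>0 < r\<close> K(2) by auto
  then have "z \<notin> K"
    using pz(2) nearest_cell_Int[OF K(2) pz(1)] by (auto simp: C_def)
  \<comment> \<open>The point \<open>z\<close> is farthest from \<open>K\<close>, but its preimage \<open>w\<close> will be farther still.\<close>
  obtain i q where iq: "(i, q) \<in> J" "z \<in> CB_derivative (subtopology ?T (A (i, q))) \<gamma>"
    using cover[of \<gamma>] pz(3) by force
  then have "f i q \<in> K"
    using good by blast
  obtain w where w: "w \<in> CB_derivative (subtopology ?T (C q)) \<gamma>" "z = f i w"
    using A_sub[OF iq(1)] iq(2) by blast
  have "w \<in> D q"
    using w(1) CB_derivative_subtopology_mono[of ?T "C q" \<gamma>]
      CB_derivative_subset_topspace[of "subtopology ?T (C q)" \<gamma>] by (auto simp: D_def)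
  have "q \<in> K" "i \<in> {1..n}"
    using iq(1) by (auto simp: J_def)
  have "w \<noteq> q"
    using \<open>z \<notin> K\<close> \<open>f i q \<in> K\<close> w(2) by blast
  have "w \<in> Y" "q \<in> Y"
    using \<open>w \<in> D q\<close> \<open>q \<in> K\<close> K(2) C(2)[OF \<open>q \<in> K\<close>] by (auto simp: D_def)
  have "d z p \<le> d z (f i q)"
    using pz(2) \<open>f i q \<in> K\<close> by (auto simp: C_def nearest_cell_def)
  also have "\<dots> < d w q"
    using \<open>w \<in> Y\<close> \<open>q \<in> Y\<close> f[OF \<open>i \<in> {1..n}\<close>] \<open>w \<noteq> q\<close> by (simp add: weak_contraction_on_def w(2))
  also have "\<dots> \<le> r"
    using \<open>w \<in> D q\<close> \<open>q \<in> K\<close> by (intro r(2)) (auto simp: R_def)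
  finally show False
    using pz(4) by simp
qed

lemma IFS_attractor_imp_weak:
  assumes "IFS_attractor Y d"
  shows "weak_IFS_attractor Y d"
proof -
  interpret Metric_space Y d
    using assms by (simp add: IFS_attractor_def)
  have "weak_contraction_on Y d f" if "contraction_on Y d f" for f
    unfolding weak_contraction_on_def
  proof (intro conjI ballI impI)
    obtain a where a: "f ` Y \<subseteq> Y" "a < 1" "\<forall>x\<in>Y. \<forall>y\<in>Y. d (f x) (f y) \<le> a * d x y"
      using \<open>contraction_on Y d f\<close> by (auto simp: contraction_on_def)
    then show "f ` Y \<subseteq> Y" by simp
    fix x y assume xy: "x \<in> Y" "y \<in> Y" "x \<noteq> y"
    then have "a * d x y < d x y"
      using a(2) by simp
    with a(3) xy show "d (f x) (f y) < d x y"
      by (meson le_less_trans)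
  qed
  then show ?thesis
    using assms unfolding IFS_attractor_def weak_IFS_attractor_def by blast
qed

section \<open>Spaces of limit height\<close>

lemma limit_height_not_weak_IFS_attractor:
  fixes T :: "'a topology" and Y :: "'b set"
  assumes "compact_space T" "scattered_space T" "limit_ord (CB_height T)"
    and attractor: "weak_IFS_attractor Y e"
    and homeo: "T homeomorphic_space Metric_space.mtopology Y e"
  shows False
proof (rule not_weak_IFS_attractor_limit_derivative[OF attractor assms(3)])
  interpret Y: Metric_space Y e
    using attractor by (simp add: weak_IFS_attractor_def)
  let ?U = "Y.mtopology"
  have U: "compact_space ?U" "Hausdorff_space ?U"
    using attractor Y.Hausdorff_space_mtopology by (auto simp: weak_IFS_attractor_def)
  then have T: "Hausdorff_space T"
    using homeo homeomorphic_Hausdorff_space by blast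
  obtain h k where "homeomorphic_maps T ?U h k"
    using homeo by (auto simp: homeomorphic_space_def)
  then have "homeomorphic_map T ?U h" "homeomorphic_map ?U T k"
    by (simp_all add: homeomorphic_maps_map)
  then have h: "continuous_map T ?U h" "h ` topspace T = topspace ?U"
    and k: "continuous_map ?U T k" "k ` topspace ?U = topspace T"
    by (blast intro: homeomorphic_imp_continuous_map dest: homeomorphic_imp_surjective_map)+
  have le1: "CB_derivative ?U \<alpha> \<subseteq> h ` CB_derivative T \<alpha>" for \<alpha> :: "'a ordinal"
    using CB_derivative_image_subset[OF assms(1) T U(2) h] .
  have le2: "CB_derivative T \<alpha> \<subseteq> k ` CB_derivative ?U \<alpha>" for \<alpha> :: "'a ordinal"
    using CB_derivative_image_subset[OF U T k] .
  \<comment> \<open>Neither map can create rank, so each derivative is covered by an image of the other.\<close>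
  have fin_iff: "discrete_subspace T (CB_derivative T \<alpha>) \<longleftrightarrow> finite (CB_derivative ?U \<alpha>)"
    for \<alpha> :: "'a ordinal"
    unfolding compact_discrete_subspace_iff_finite[OF assms(1) T closedin_CB_derivative[OF T]]
    using le1 le2 by (meson finite_surj)
  show "finite (CB_derivative ?U (CB_height T))"
    using discrete_CB_height[OF assms(2)] by (simp add: fin_iff)
  show "infinite (CB_derivative ?U \<beta>)" if "\<beta> < CB_height T" for \<beta>
    using not_discrete_below_CB_height[OF assms(2) that] by (simp add: fin_iff)
qed

theorem theorem3:
  fixes X :: "'a set" and d :: "'a \<Rightarrow> 'a \<Rightarrow> real"
  assumes "Metric_space X d"
    and "compact_space (Metric_space.mtopology X d)"
    and "scattered_space (Metric_space.mtopology X d)"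
    and "limit_ord (CB_height (Metric_space.mtopology X d))"
  shows "\<not> (\<exists>(Y :: 'b set) e. weak_IFS_attractor Y e \<and>
              Metric_space.mtopology X d homeomorphic_space Metric_space.mtopology Y e)
       \<and> \<not> topological_IFS_attractor (Metric_space.mtopology X d)"
proof
  show "\<not> (\<exists>(Y :: 'b set) e. weak_IFS_attractor Y e \<and>
              Metric_space.mtopology X d homeomorphic_space Metric_space.mtopology Y e)"
    using limit_height_not_weak_IFS_attractor[OF assms(2-4)] by blast
  show "\<not> topological_IFS_attractor (Metric_space.mtopology X d)"
    unfolding topological_IFS_attractor_def
    using limit_height_not_weak_IFS_attractor[OF assms(2-4)] IFS_attractor_imp_weak by blast
qed

end
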